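(* Suppose $e\ge1$ and $d\ge3e$. Let $f\in\mathcal{R}_d$. Then $M_{f,D}$ is closed under matrix multiplication. If furthermore $\mathrm{ann}_R(f)_e=0$, then $M_{f,D}$ is a commutative $K$-algebra.
   Context: $K$ is a field, $r\ge 1$, $R=K[\partial_1,\dots,\partial_r]$ is a polynomial ring with the standard grading, and $\mathcal{R}=K[x_1,\dots,x_r]^{DP}=\bigoplus_{d\ge0}\mathcal{R}_d$ is the divided power ring: $\mathcal{R}_d$ has $K$-basis $x^{(\alpha)}=\prod_i x_i^{(\alpha_i)}$, $|\alpha|=d$, with multiplication generated by $x_i^{(a)}x_i^{(b)}=\binom{a+b}{a}x_i^{(a+b)}$. $R$ acts on $\mathcal{R}$ by $\partial^\beta(x^{(\alpha)})=x^{(\alpha-\beta)}$ (zero if some $\alpha_i<\beta_i$). $\mathrm{ann}_R(f)=\{D\in R:Df=0\}$, with degree $e$ part $\mathrm{ann}_R(f)_e$. Fix $e\ge1$, let $N=\dim_KR_e=\binom{r-1+e}{e}$, choose a basis $D_1,\dots,D_N$ of $R_e$, and let $D=[D_1,\dots,D_N]^T$. For $f\in\mathcal{R}_d$, $$M_{f,D}=\{A\in\mathrm{Mat}_K(N,N):I_2(D\;AD)\subseteq\mathrm{ann}_R(f)\},$$ where $I_2(D\;AD)$ is the ideal of $R$ generated by the $2\times2$ minors of the $N\times2$ matrix with columns $D$ and $AD$. *)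

theory Defs
  imports
    "HOL-Library.Poly_Mapping"
    "HOL-Library.Cardinality"
    "HOL-Algebra.Ideal"
    "Jordan_Normal_Form.VS_Connect"
begin

text \<open>
  The finite type \<open>'r\<close> indexes the variables, so \<open>r = CARD('r)\<close> and \<open>r \<ge> 1\<close> is automatic.
  The ring \<open>R = K[\<partial>\<^sub>1,\<dots>,\<partial>\<^sub>r]\<close> is the type \<open>('r, 'k) mpoly\<close>; its
  library multiplication is the convolution product.
\<close>

type_synonym ('r, 'k) mpoly = "('r \<Rightarrow>\<^sub>0 nat) \<Rightarrow>\<^sub>0 'k"

text \<open>
  The divided power ring, as a graded \<open>K\<close>-vector space with basis the divided monomials
  \<open>x\<^sup>(\<^sup>\<alpha>\<^sup>)\<close>: the element \<open>Poly_Mapping.single \<alpha> c\<close> stands for \<open>c x\<^sup>(\<^sup>\<alpha>\<^sup>)\<close>.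
  Only its \<open>R\<close>-module structure \<open>contract\<close> below is needed. The product \<open>(*)\<close> that the
  library puts on this type is the polynomial one, not the divided power product, and is never
  applied to elements of \<open>('r, 'k) divpow\<close>.
\<close>

type_synonym ('r, 'k) divpow = "('r \<Rightarrow>\<^sub>0 nat) \<Rightarrow>\<^sub>0 'k"

definition mon_deg :: "('r::finite \<Rightarrow>\<^sub>0 nat) \<Rightarrow> nat" where
  "mon_deg \<alpha> = (\<Sum>i\<in>UNIV. Poly_Mapping.lookup \<alpha> i)"

text \<open>Serves both for the pieces \<open>R\<^sub>d\<close> and for those of the divided power ring.\<close>

definition graded_piece :: "nat \<Rightarrow> (('r::finite \<Rightarrow>\<^sub>0 nat) \<Rightarrow>\<^sub>0 'k::field) set" where
  "graded_piece d = {p. \<forall>\<alpha>\<in>Poly_Mapping.keys p. mon_deg \<alpha> = d}"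

text \<open>The bilinear extension of \<open>\<partial>\<^sup>\<beta>(x\<^sup>(\<^sup>\<alpha>\<^sup>)) = x\<^sup>(\<^sup>\<alpha>\<^sup>-\<^sup>\<beta>\<^sup>)\<close>, zero unless \<open>\<beta> \<le> \<alpha>\<close>.\<close>

definition contract :: "('r::finite, 'k::field) mpoly \<Rightarrow> ('r, 'k) divpow \<Rightarrow> ('r, 'k) divpow" where
  "contract P f =
    (\<Sum>\<beta>\<in>Poly_Mapping.keys P. \<Sum>\<alpha>\<in>Poly_Mapping.keys f.
      if \<forall>i. Poly_Mapping.lookup \<beta> i \<le> Poly_Mapping.lookup \<alpha> i
      then Poly_Mapping.single (\<alpha> - \<beta>) (Poly_Mapping.lookup P \<beta> * Poly_Mapping.lookup f \<alpha>)
      else 0)"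

definition ann :: "('r::finite, 'k::field) divpow \<Rightarrow> ('r, 'k) mpoly set" where
  "ann f = {P. contract P f = 0}"

definition const_poly :: "'k::field \<Rightarrow> ('r::finite, 'k) mpoly" where
  "const_poly c = Poly_Mapping.single 0 c"

text \<open>\<open>R\<close> as a vector space over \<open>K\<close>.\<close>

global_interpretation mpoly_vs:
  vector_space "\<lambda>(c::'k::field) (P::('r::finite, 'k) mpoly). const_poly c * P"
  by unfold_locales
    (simp_all add: const_poly_def distrib_left distrib_right single_add mult_single flip: mult.assoc)

definition is_basis :: "('r::finite, 'k::field) mpoly vec \<Rightarrow> ('r, 'k) mpoly set \<Rightarrow> bool" where
  "is_basis D V \<longleftrightarrow>
    inj_on (\<lambda>i. D $ i) {..<dim_vec D} \<and>
    mpoly_vs.independent ((\<lambda>i. D $ i) ` {..<dim_vec D}) \<and>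
    mpoly_vs.span ((\<lambda>i. D $ i) ` {..<dim_vec D}) = V"

definition minors2 :: "'a::comm_ring_1 mat \<Rightarrow> 'a set" where
  "minors2 M = {M $$ (i, j) * M $$ (i', j') - M $$ (i, j') * M $$ (i', j) | i i' j j'.
    i < i' \<and> i' < dim_row M \<and> j < j' \<and> j' < dim_col M}"

definition I2 :: "'a::comm_ring_1 mat \<Rightarrow> 'a set" where
  "I2 M = Idl\<^bsub>class_ring\<^esub> (minors2 M)"

text \<open>\<open>M\<^bsub>f,D\<^esub>\<close>; in \<open>AD\<close> the scalar matrix \<open>A\<close> acts on the column \<open>D\<close> of polynomials.\<close>

definition Mset ::
    "('r::finite, 'k::field) divpow \<Rightarrow> ('r, 'k) mpoly vec \<Rightarrow> 'k mat set" where
  "Mset f D = {A \<in> carrier_mat (dim_vec D) (dim_vec D).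
    I2 (mat_of_cols (dim_vec D) [D, map_mat const_poly A *\<^sub>v D]) \<subseteq> ann f}"

text \<open>\<open>M\<^bsub>f,D\<^esub>\<close> with the operations, zero and identity of the full matrix algebra.\<close>

definition Malg ::
    "('r::finite, 'k::field) divpow \<Rightarrow> ('r, 'k) mpoly vec \<Rightarrow> ('k, 'k mat) module" where
  "Malg f D = module_mat TYPE('k) (dim_vec D) (dim_vec D) \<lparr>carrier := Mset f D\<rparr>"

end

theory Submission
  imports Defs
begin

text \<open>
  Write \<open>P \<sim> Q\<close> for \<open>contract P f = contract Q f\<close>. Contraction is an \<open>R\<close>-module structure
  (\<open>contract_mult\<close>), so \<open>\<sim>\<close> is congruence modulo the ideal \<open>ann f\<close>. Put
  \<open>a\<^sub>i = (AD)\<^sub>i\<close> and \<open>b\<^sub>i = (BD)\<^sub>i\<close>. Membership of \<open>A\<close> in \<open>Mset f D\<close> says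
  \<open>D\<^sub>i a\<^sub>j \<sim> D\<^sub>j a\<^sub>i\<close> for all \<open>i, j\<close>, and likewise for \<open>B\<close> and \<open>b\<close>.

  Applying \<open>A\<close> to the relations \<open>D\<^sub>i b\<^sub>j \<sim> D\<^sub>j b\<^sub>i\<close> with \<open>i\<close> fixed gives
  \<open>D\<^sub>i (ABD)\<^sub>k \<sim> a\<^sub>k b\<^sub>i\<close> (\<open>contract_mact_mult\<close>). So \<open>AB\<close> lies in \<open>Mset f D\<close> as soon as
  \<open>a\<^sub>k b\<^sub>i \<sim> a\<^sub>i b\<^sub>k\<close>. The given relations always involve an entry of \<open>D\<close>, so they
  do not apply to these products of degree \<open>2e\<close>; but after multiplication by any \<open>D\<^sub>l\<close> they give
  \<open>D\<^sub>l a\<^sub>k b\<^sub>i \<sim> D\<^sub>k a\<^sub>l b\<^sub>i \<sim> D\<^sub>i a\<^sub>l b\<^sub>k \<sim> D\<^sub>l a\<^sub>i b\<^sub>k\<close>.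
  Thus \<open>R\<^sub>e\<close> kills the element obtained by contracting \<open>f\<close> with \<open>a\<^sub>k b\<^sub>i - a\<^sub>i b\<^sub>k\<close>. That
  element has degree \<open>d - 2e \<ge> e\<close>, and a form of degree at least \<open>e\<close> that is killed by \<open>R\<^sub>e\<close>
  vanishes (\<open>eq_zero_if_contracted_to_zero\<close>), because every coefficient of it is also a
  coefficient of its contraction by some monomial of degree \<open>e\<close>. This is where \<open>d \<ge> 3e\<close> enters.

  The relation \<open>a\<^sub>k b\<^sub>i \<sim> a\<^sub>i b\<^sub>k\<close> is symmetric under exchange of \<open>A\<close> and \<open>B\<close>, so
  \<open>D\<^sub>i (ABD)\<^sub>k \<sim> D\<^sub>i (BAD)\<^sub>k\<close>. By the same vanishing principle \<open>((AB - BA) D)\<^sub>k\<close> annihilates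
  \<open>f\<close>. If \<open>ann f\<close> is zero in degree \<open>e\<close>, this entry is zero, and \<open>AB = BA\<close> because the entries of
  \<open>D\<close> are linearly independent.
\<close>

section \<open>Contraction\<close>

text \<open>
  Read off coefficientwise, contraction is a sum over the monomials of \<open>P\<close> alone: the case
  distinction on \<open>\<beta> \<le> \<alpha>\<close> disappears, since the only \<open>\<alpha>\<close> contributing to \<open>\<gamma>\<close> is \<open>\<gamma> + \<beta>\<close>.
\<close>

lemma lookup_contract:
  "Poly_Mapping.lookup (contract P f) \<gamma> =
    (\<Sum>\<beta>\<in>Poly_Mapping.keys P. Poly_Mapping.lookup P \<beta> * Poly_Mapping.lookup f (\<gamma> + \<beta>))"
proof -
  have inner: "(\<Sum>\<alpha>\<in>Poly_Mapping.keys f. Poly_Mapping.lookup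
        (if \<forall>i. Poly_Mapping.lookup \<beta> i \<le> Poly_Mapping.lookup \<alpha> i
          then Poly_Mapping.single (\<alpha> - \<beta>) (Poly_Mapping.lookup P \<beta> * Poly_Mapping.lookup f \<alpha>) else 0) \<gamma>)
      = Poly_Mapping.lookup P \<beta> * Poly_Mapping.lookup f (\<gamma> + \<beta>)" for \<beta>
  proof -
    have shift: "(\<forall>i. Poly_Mapping.lookup \<beta> i \<le> Poly_Mapping.lookup \<alpha> i) \<and> \<alpha> - \<beta> = \<gamma> \<longleftrightarrow> \<alpha> = \<gamma> + \<beta>" for \<alpha>
      by (auto simp: poly_mapping_eq_iff fun_eq_iff lookup_add lookup_minus)
        (metis le_add_diff_inverse2)
    have "Poly_Mapping.lookup (if \<forall>i. Poly_Mapping.lookup \<beta> i \<le> Poly_Mapping.lookup \<alpha> i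
          then Poly_Mapping.single (\<alpha> - \<beta>) (Poly_Mapping.lookup P \<beta> * Poly_Mapping.lookup f \<alpha>) else 0) \<gamma>
        = (if \<alpha> = \<gamma> + \<beta> then Poly_Mapping.lookup P \<beta> * Poly_Mapping.lookup f (\<gamma> + \<beta>) else 0)" for \<alpha>
      using shift[of \<alpha>] by (auto simp: lookup_single when_def)
    then show ?thesis
      by (simp add: sum.delta in_keys_iff)
  qed
  show ?thesis
    unfolding contract_def lookup_sum by (rule sum.cong[OF refl inner])
qed

lemma lookup_contract_superset:
  assumes "finite S" "Poly_Mapping.keys P \<subseteq> S"
  shows "Poly_Mapping.lookup (contract P f) \<gamma> = (\<Sum>\<beta>\<in>S. Poly_Mapping.lookup P \<beta> * Poly_Mapping.lookup f (\<gamma> + \<beta>))"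
  unfolding lookup_contract
  by (rule sum.mono_neutral_left) (use assms in \<open>auto simp: in_keys_iff\<close>)

lemma contract_zero_left [simp]: "contract 0 f = 0"
  by (simp add: contract_def)

lemma contract_zero_right [simp]: "contract P 0 = 0"
  by (simp add: contract_def)

lemma contract_add_left: "contract (P + Q) f = contract P f + contract Q f"
proof (rule poly_mapping_eqI)
  fix \<gamma>
  let ?S = "Poly_Mapping.keys P \<union> Poly_Mapping.keys Q"
  have "Poly_Mapping.keys (P + Q) \<subseteq> ?S"
    by (auto simp: in_keys_iff lookup_add)
  then show "Poly_Mapping.lookup (contract (P + Q) f) \<gamma> = Poly_Mapping.lookup (contract P f + contract Q f) \<gamma>"
    unfolding lookup_add
    by (simp add: lookup_contract_superset[of ?S] lookup_add distrib_right sum.distrib)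
qed

lemma contract_diff_left: "contract (P - Q) f = contract P f - contract Q f"
  using contract_add_left[of "P - Q" Q f] by (simp add: algebra_simps)

lemma contract_sum_left: "contract (\<Sum>j\<in>S. P j) f = (\<Sum>j\<in>S. contract (P j) f)"
  by (induction S rule: infinite_finite_induct) (simp_all add: contract_add_left)

lemma lookup_contract_single:
  "Poly_Mapping.lookup (contract (Poly_Mapping.single \<beta> c) f) \<gamma> = c * Poly_Mapping.lookup f (\<gamma> + \<beta>)"
  by (subst lookup_contract_superset[of "{\<beta>}"]) simp_all

lemma poly_mapping_add_induct [case_names zero single add]:
  fixes p :: "'a \<Rightarrow>\<^sub>0 'b::comm_monoid_add"
  assumes "P 0" "\<And>a b. P (Poly_Mapping.single a b)" "\<And>p q. P p \<Longrightarrow> P q \<Longrightarrow> P (p + q)"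
  shows "P p"
proof -
  have "P (\<Sum>k\<in>S. Poly_Mapping.single k (Poly_Mapping.lookup p k))" for S
    by (induction S rule: infinite_finite_induct) (simp_all add: assms)
  moreover have "p = (\<Sum>k\<in>Poly_Mapping.keys p. Poly_Mapping.single k (Poly_Mapping.lookup p k))"
    by (rule poly_mapping_eqI)
      (simp add: lookup_sum lookup_single when_def in_keys_iff)
  ultimately show ?thesis
    by metis
qed

text \<open>
  The module law. Both sides are additive in \<open>P\<close> and \<open>Q\<close>, and for monomials it says that shifting
  exponents by \<open>\<beta>\<close> and then by \<open>\<gamma>\<close> is shifting by \<open>\<beta> + \<gamma>\<close>.
\<close>
lemma contract_mult: "contract (P * Q) f = contract P (contract Q f)"
proof (induction P rule: poly_mapping_add_induct)
  case (single \<beta> b)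
  show ?case
  proof (induction Q rule: poly_mapping_add_induct)
    case (single \<gamma> c)
    show ?case
      by (rule poly_mapping_eqI) (simp add: mult_single lookup_contract_single ac_simps)
  next
    case (add p q)
    have "contract (Poly_Mapping.single \<beta> b) (g + h) = 
        contract (Poly_Mapping.single \<beta> b) g + contract (Poly_Mapping.single \<beta> b) h" for g h
      by (rule poly_mapping_eqI) (simp add: lookup_contract_single lookup_add distrib_left)
    with add show ?case
      by (simp add: distrib_left contract_add_left)
  qed simp
qed (simp_all add: distrib_right contract_add_left)

lemma contract_mult_left_cong:
  "contract Q f = contract Q' f \<Longrightarrow> contract (P * Q) f = contract (P * Q') f"
  by (simp add: contract_mult)

lemma contract_graded_piece:
  assumes "P \<in> graded_piece m" "f \<in> graded_piece d"
  shows "contract P f \<in> graded_piece (d - m)"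
proof -
  have "mon_deg \<gamma> = d - m" if nz: "Poly_Mapping.lookup (contract P f) \<gamma> \<noteq> 0" for \<gamma>
  proof -
    obtain \<beta> where "\<beta> \<in> Poly_Mapping.keys P"
        "Poly_Mapping.lookup P \<beta> * Poly_Mapping.lookup f (\<gamma> + \<beta>) \<noteq> 0"
      using nz unfolding lookup_contract by (rule sum.not_neutral_contains_not_neutral)
    then have "mon_deg \<beta> = m" "mon_deg (\<gamma> + \<beta>) = d"
      using assms by (auto simp: graded_piece_def in_keys_iff)
    then show ?thesis
      by (simp add: mon_deg_def lookup_add sum.distrib)
  qed
  then show ?thesis
    by (simp add: graded_piece_def in_keys_iff)
qed

lemma mon_deg_add: "mon_deg (\<alpha> + \<beta>) = mon_deg \<alpha> + mon_deg \<beta>"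
  by (simp add: mon_deg_def lookup_add sum.distrib)

lemma exists_submonomial:
  assumes "e \<le> mon_deg \<gamma>"
  shows "\<exists>\<alpha> \<beta>. \<gamma> = \<alpha> + \<beta> \<and> mon_deg \<beta> = e"
  using assms
proof (induction e)
  case 0
  show ?case
    by (rule exI[of _ \<gamma>], rule exI[of _ 0]) (simp add: mon_deg_def)
next
  case (Suc e)
  then obtain \<alpha> \<beta> where ab: "\<gamma> = \<alpha> + \<beta>" "mon_deg \<beta> = e"
    by auto
  with Suc.prems have "mon_deg \<alpha> \<noteq> 0"
    by (auto simp: mon_deg_add)
  then obtain i where i: "Poly_Mapping.lookup \<alpha> i \<noteq> 0"
    by (metis mon_deg_def sum.neutral)
  let ?x = "Poly_Mapping.single i (1::nat)"
  have "\<gamma> = (\<alpha> - ?x) + (?x + \<beta>)"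
    using i by (auto simp: ab poly_mapping_eq_iff fun_eq_iff lookup_add lookup_minus
        lookup_single when_def)
  moreover have "mon_deg (?x + \<beta>) = Suc e"
    using ab by (simp add: mon_deg_def lookup_add sum.distrib lookup_single when_def)
  ultimately show ?case
    by blast
qed

text \<open>
  The coefficient of \<open>h\<close> at \<open>\<alpha> + \<beta>\<close> is the coefficient at \<open>\<alpha>\<close> of the contraction of \<open>h\<close> by the
  monomial \<open>\<beta>\<close>; no binomial coefficient appears, so this works in every characteristic.
\<close>
lemma eq_zero_if_contracted_to_zero:
  assumes h: "h \<in> graded_piece m" and "e \<le> m"
    and kill: "\<And>P. P \<in> graded_piece e \<Longrightarrow> contract P h = 0"
  shows "h = 0"
proof (rule poly_mapping_eqI)
  fix \<gamma>
  show "Poly_Mapping.lookup h \<gamma> = Poly_Mapping.lookup 0 \<gamma>"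
  proof (cases "mon_deg \<gamma> = m")
    case True
    then obtain \<alpha> \<beta> where ab: "\<gamma> = \<alpha> + \<beta>" "mon_deg \<beta> = e"
      using exists_submonomial \<open>e \<le> m\<close> by metis
    have "contract (Poly_Mapping.single \<beta> 1) h = 0"
      by (rule kill) (simp add: graded_piece_def ab)
    then have "Poly_Mapping.lookup (contract (Poly_Mapping.single \<beta> 1) h) \<alpha> = 0"
      by simp
    then show ?thesis
      by (simp add: lookup_contract_single ab)
  next
    case False
    with h show ?thesis
      by (auto simp: graded_piece_def in_keys_iff)
  qed
qed

section \<open>Annihilators and the matrix condition\<close>

lemma ideal_ann: "ideal (ann f) class_ring"
proof (rule idealI)
  show "ring (class_ring :: ('a, 'b) mpoly ring)"
    by (rule class_ring.ring_axioms)
  show "subgroup (ann f) (add_monoid class_ring)"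
  proof (rule group.subgroupI)
    show "Group.group (add_monoid (class_ring :: ('a, 'b) mpoly ring))"
      by (rule abelian_group.a_group[OF ring.is_abelian_group[OF class_ring.ring_axioms]])
  next
    show "ann f \<noteq> {}"
      by (auto simp: ann_def intro: exI[of _ 0])
  next
    fix P assume "P \<in> ann f"
    moreover have "\<ominus>\<^bsub>class_ring\<^esub> P = - P"
      by (simp only: class_ring_simps)
    ultimately show "inv\<^bsub>add_monoid class_ring\<^esub> P \<in> ann f"
      using contract_diff_left[of 0 P f] unfolding a_inv_def by (simp add: ann_def)
  qed (auto simp: ann_def contract_add_left)
next
  fix P Q assume "P \<in> ann f"
  then show "Q \<otimes>\<^bsub>class_ring\<^esub> P \<in> ann f" "P \<otimes>\<^bsub>class_ring\<^esub> Q \<in> ann f"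
    using contract_mult[of Q P f] by (simp_all add: ann_def mult.commute[of P])
qed

text \<open>
  The entries of the column \<open>AD\<close>, as a finite sum over the entries of \<open>D\<close>, which is the form needed
  for linearity arguments.
\<close>
definition mact :: "('r::finite, 'k::field) mpoly vec \<Rightarrow> 'k mat \<Rightarrow> nat \<Rightarrow> ('r, 'k) mpoly" where
  "mact D A i = (\<Sum>j<dim_vec D. const_poly (A $$ (i, j)) * D $ j)"

text \<open>
  Since \<open>ann f\<close> is an ideal, it contains \<open>I2\<close> of a matrix as soon as it contains its minors. The
  matrix has only two columns, so a minor is a choice of rows \<open>i < j\<close>; the condition is symmetric
  in \<open>i\<close> and \<open>j\<close> and trivial for \<open>i = j\<close>, which allows stating it for all pairs.
\<close>
lemma Mset_iff:
  "A \<in> Mset f D \<longleftrightarrow> A \<in> carrier_mat (dim_vec D) (dim_vec D) \<and>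
    (\<forall>i<dim_vec D. \<forall>j<dim_vec D. contract (D $ i * mact D A j) f = contract (D $ j * mact D A i) f)"
proof (cases "A \<in> carrier_mat (dim_vec D) (dim_vec D)")
  case True
  let ?n = "dim_vec D"
  let ?M = "mat_of_cols ?n [D, map_mat const_poly A *\<^sub>v D]"
  have col2: "(map_mat const_poly A *\<^sub>v D) $ i = mact D A i" if "i < ?n" for i
    using True that by (auto simp: mact_def scalar_prod_def lessThan_atLeast0)
  have minors: "minors2 ?M =
      {D $ i * mact D A j - mact D A i * D $ j | i j. i < j \<and> j < ?n}"
  proof -
    have cols: "j < j' \<and> j' < dim_col ?M \<longleftrightarrow> j = 0 \<and> j' = 1" for j j'
      by auto
    have entries: "?M $$ (i, 0) = D $ i" "?M $$ (i, 1) = mact D A i" if "i < ?n" for i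
      using that col2 by (simp_all add: mat_of_cols_index)
    have "minors2 ?M = {?M $$ (i, 0) * ?M $$ (j, 1) - ?M $$ (i, 1) * ?M $$ (j, 0) | i j.
        i < j \<and> j < ?n}"
      unfolding minors2_def cols by simp
    also have "\<dots> = {D $ i * mact D A j - mact D A i * D $ j | i j. i < j \<and> j < ?n}"
      by (intro Collect_cong ex_cong1 refl)
        (auto simp: entries simp del: One_nat_def)
    finally show ?thesis .
  qed
  have "I2 ?M \<subseteq> ann f \<longleftrightarrow> minors2 ?M \<subseteq> ann f"
    unfolding I2_def by (rule ring.Idl_subset_ideal[OF class_ring.ring_axioms ideal_ann]) simp
  also have "\<dots> \<longleftrightarrow> (\<forall>i j. i < j \<and> j < ?n \<longrightarrow>
      contract (D $ i * mact D A j) f = contract (D $ j * mact D A i) f)"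
  proof -
    have "D $ i * mact D A j - mact D A i * D $ j \<in> ann f \<longleftrightarrow>
        contract (D $ i * mact D A j) f = contract (D $ j * mact D A i) f" for i j
      by (simp add: ann_def contract_diff_left mult.commute)
    then show ?thesis
      unfolding minors by blast
  qed
  also have "\<dots> \<longleftrightarrow> (\<forall>i<?n. \<forall>j<?n.
      contract (D $ i * mact D A j) f = contract (D $ j * mact D A i) f)"
    (is "?ordered \<longleftrightarrow> _")
  proof (intro iffI allI impI)
    fix i j assume ordered: ?ordered and i: "i < ?n" and j: "j < ?n"
    show "contract (D $ i * mact D A j) f = contract (D $ j * mact D A i) f"
    proof (cases i j rule: linorder_cases)
      case less
      with ordered j show ?thesis by blast
    next
      case greater
      with ordered i have "contract (D $ j * mact D A i) f = contract (D $ i * mact D A j) f"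
        by blast
      then show ?thesis by (rule sym)
    qed simp
  qed simp
  finally show ?thesis
    using True by (simp add: Mset_def)
qed (simp add: Mset_def)

lemma const_poly_add: "const_poly (a + b) = const_poly a + const_poly b"
  by (simp add: const_poly_def single_add)

lemma const_poly_zero [simp]: "const_poly 0 = 0"
  by (simp add: const_poly_def)

lemma const_poly_one [simp]: "const_poly 1 = 1"
  by (simp add: const_poly_def)

lemma const_poly_sum: "const_poly (\<Sum>j\<in>S. a j) = (\<Sum>j\<in>S. const_poly (a j))"
  by (induction S rule: infinite_finite_induct) (simp_all add: const_poly_add)

context
  fixes D :: "('r::finite, 'k::field) mpoly vec" and n
  assumes n: "n = dim_vec D"
begin

lemma mact_add:
  assumes "A \<in> carrier_mat n n" "B \<in> carrier_mat n n" "i < n"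
  shows "mact D (A + B) i = mact D A i + mact D B i"
  using assms by (simp add: mact_def n const_poly_add distrib_right sum.distrib)

lemma mact_smult:
  assumes "A \<in> carrier_mat n n" "i < n"
  shows "mact D (c \<cdot>\<^sub>m A) i = const_poly c * mact D A i"
  using assms by (simp add: mact_def n sum_distrib_left)

lemma mact_zero: "i < n \<Longrightarrow> mact D (0\<^sub>m n n) i = 0"
  by (simp add: mact_def n)

lemma mact_one: "i < n \<Longrightarrow> mact D (1\<^sub>m n) i = D $ i"
  by (simp add: mact_def n if_distrib if_distribR sum.delta cong: if_cong)

lemma mact_mult:
  assumes "A \<in> carrier_mat n n" "B \<in> carrier_mat n n" "k < n"
  shows "mact D (A * B) k = (\<Sum>j<n. const_poly (A $$ (k, j)) * mact D B j)"
proof -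
  have "mact D (A * B) k = (\<Sum>i<n. \<Sum>j<n. const_poly (A $$ (k, j) * B $$ (j, i)) * D $ i)"
    using assms
    by (simp add: mact_def n scalar_prod_def lessThan_atLeast0 const_poly_sum sum_distrib_right)
  also have "\<dots> = (\<Sum>j<n. \<Sum>i<n. const_poly (A $$ (k, j) * B $$ (j, i)) * D $ i)"
    by (rule sum.swap)
  also have "\<dots> = (\<Sum>j<n. const_poly (A $$ (k, j)) * mact D B j)"
    by (simp add: mact_def n sum_distrib_left)
  finally show ?thesis .
qed

text \<open>
  The relation for \<open>B\<close> exchanges the roles of \<open>D\<close> and \<open>BD\<close> in \<open>D\<^sub>i (BD)\<^sub>j\<close>; taking the linear
  combination over \<open>j\<close> with the coefficients from row \<open>k\<close> of \<open>A\<close> turns \<open>(BD)\<^sub>j\<close> into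
  \<open>(ABD)\<^sub>k\<close> on one side and \<open>D\<^sub>j\<close> into \<open>(AD)\<^sub>k\<close> on the other.
\<close>
lemma contract_mact_mult:
  assumes A: "A \<in> carrier_mat n n" and B: "B \<in> Mset f D" and i: "i < n" and k: "k < n"
  shows "contract (D $ i * mact D (A * B) k) f = contract (mact D A k * mact D B i) f"
proof -
  have Bc: "B \<in> carrier_mat n n"
    using B by (simp add: Mset_iff n)
  have swap: "contract (D $ i * mact D B j) f = contract (D $ j * mact D B i) f" if "j < n" for j
    using B i that by (simp add: Mset_iff n)
  have "contract (D $ i * mact D (A * B) k) f =
      (\<Sum>j<n. contract (const_poly (A $$ (k, j)) * (D $ i * mact D B j)) f)"
    by (simp add: mact_mult[OF A Bc k] sum_distrib_left contract_sum_left mult.left_commute)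
  also have "\<dots> = (\<Sum>j<n. contract (const_poly (A $$ (k, j)) * (D $ j * mact D B i)) f)"
    by (intro sum.cong refl contract_mult_left_cong swap) simp
  also have "\<dots> = contract (mact D A k * mact D B i) f"
    by (simp add: mact_def[of D A] n sum_distrib_right contract_sum_left mult.assoc)
  finally show ?thesis .
qed

lemma zero_in_Mset: "0\<^sub>m n n \<in> Mset f D"
  by (auto simp: Mset_iff mact_zero n[symmetric])

lemma one_in_Mset: "1\<^sub>m n \<in> Mset f D"
  by (auto simp: Mset_iff mact_one n[symmetric] mult.commute)

lemma add_in_Mset: "A \<in> Mset f D \<Longrightarrow> B \<in> Mset f D \<Longrightarrow> A + B \<in> Mset f D"
  by (auto simp: Mset_iff mact_add n[symmetric] distrib_left contract_add_left)

lemma smult_in_Mset: "A \<in> Mset f D \<Longrightarrow> c \<cdot>\<^sub>m A \<in> Mset f D"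
  by (auto simp: Mset_iff mact_smult n[symmetric] mult.left_commute[of _ "const_poly c"]
      intro!: contract_mult_left_cong)

end

section \<open>Bases of a graded piece\<close>

context
  fixes D :: "('r::finite, 'k::field) mpoly vec" and e n
  assumes basis: "is_basis D (graded_piece e)" and n: "n = dim_vec D"
begin

text \<open>
  The polynomials annihilating \<open>h\<close> form a linear subspace, so it suffices to test a basis of \<open>R\<^sub>e\<close>.
\<close>
lemma contracted_to_zero_by_basis:
  assumes h: "h \<in> graded_piece m" and "e \<le> m" and kill: "\<And>l. l < n \<Longrightarrow> contract (D $ l) h = 0"
  shows "h = 0"
proof (rule eq_zero_if_contracted_to_zero[OF h \<open>e \<le> m\<close>])
  fix P :: "('r, 'k) mpoly"
  assume "P \<in> graded_piece e"
  then have "P \<in> mpoly_vs.span ((\<lambda>i. D $ i) ` {..<dim_vec D})"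
    using basis by (simp add: is_basis_def)
  then show "contract P h = 0"
  proof (induction rule: mpoly_vs.span_induct_alt)
    case base
    show ?case by simp
  next
    case (step c P Q)
    then show ?case
      using kill by (auto simp: contract_add_left contract_mult n)
  qed
qed

lemma mact_in_graded_piece: "mact D A k \<in> graded_piece e"
proof -
  have "mact D A k \<in> mpoly_vs.span ((\<lambda>i. D $ i) ` {..<dim_vec D})"
    unfolding mact_def
    by (intro mpoly_vs.span_sum mpoly_vs.span_scale mpoly_vs.span_base) simp
  then show ?thesis
    using basis by (simp add: is_basis_def)
qed

text \<open>The rows of \<open>A\<close> are coordinate vectors with respect to the basis \<open>D\<close>.\<close>
lemma mact_inject:
  assumes A: "A \<in> carrier_mat n n" and B: "B \<in> carrier_mat n n"
    and eq: "\<And>k. k < n \<Longrightarrow> mact D A k = mact D B k"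
  shows "A = B"
proof (rule eq_matI)
  fix k j assume "k < dim_row B" "j < dim_col B"
  then have k: "k < n" and j: "j < n"
    using B by auto
  let ?S = "(\<lambda>i. D $ i) ` {..<n}"
  have inj: "inj_on (\<lambda>i. D $ i) {..<n}" and indep: "mpoly_vs.independent ?S"
    using basis by (auto simp: is_basis_def n)
  \<comment> \<open>Linear independence of a set is about coefficients indexed by its elements, so the
    coefficients are moved from the indices \<open>i\<close> to the polynomials \<open>D $ i\<close>.\<close>
  define u where "u v = (let i = the_inv_into {..<n} (\<lambda>i. D $ i) v in A $$ (k, i) - B $$ (k, i))" for v
  have u: "u (D $ i) = A $$ (k, i) - B $$ (k, i)" if "i < n" for i
    using that inj by (simp add: u_def the_inv_into_f_f)
  have diff: "const_poly (a - b) = const_poly a - const_poly b" for a b :: 'k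
    by (simp add: const_poly_def single_diff)
  have "(\<Sum>v\<in>?S. const_poly (u v) * v) = (\<Sum>i<n. const_poly (u (D $ i)) * D $ i)"
    by (simp add: sum.reindex[OF inj])
  also have "\<dots> = mact D A k - mact D B k"
    by (simp add: mact_def n[symmetric] u diff left_diff_distrib sum_subtractf)
  also have "\<dots> = 0"
    using eq[OF k] by simp
  finally have "u (D $ j) = 0"
    using mpoly_vs.independentD[OF indep, of ?S u "D $ j"] j by auto
  then show "A $$ (k, j) = B $$ (k, j)"
    using u[OF j] by simp
qed (use A B in auto)

text \<open>
  The heart of the argument: the defining relations of \<open>Mset f D\<close> do not apply to products of
  entries of \<open>AD\<close> with entries of \<open>BD\<close>, but with a third factor \<open>D\<^sub>l\<close> the indices can be permuted,
  and \<open>3e \<le> d\<close> allows cancelling the factor \<open>D\<^sub>l\<close> again.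
\<close>
lemma contract_mact_swap:
  assumes A: "A \<in> Mset f D" and B: "B \<in> Mset f D" and f: "f \<in> graded_piece d" and d: "3 * e \<le> d"
    and i: "i < n" and k: "k < n"
  shows "contract (mact D A k * mact D B i) f = contract (mact D A i * mact D B k) f"
proof -
  let ?a = "mact D A" and ?b = "mact D B"
  let ?h = "contract (?a k * ?b i) f - contract (?a i * ?b k) f"
  have a: "contract (D $ p * ?a q) f = contract (D $ q * ?a p) f" if "p < n" "q < n" for p q
    using A that by (simp add: Mset_iff n)
  have b: "contract (D $ p * ?b q) f = contract (D $ q * ?b p) f" if "p < n" "q < n" for p q
    using B that by (simp add: Mset_iff n)
  have piece: "contract (?a p * ?b q) f \<in> graded_piece (d - e - e)" for p q
    unfolding contract_mult by (intro contract_graded_piece mact_in_graded_piece f)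
  have "?h = 0"
  proof (rule contracted_to_zero_by_basis)
    show "?h \<in> graded_piece (d - e - e)"
      using piece[of k i] piece[of i k] Poly_Mapping.keys_diff
      by (fastforce simp: graded_piece_def)
    show "e \<le> d - e - e"
      using d by simp
    fix l assume l: "l < n"
    \<comment> \<open>Exchange \<open>l\<close> and \<open>k\<close> by the relation for \<open>A\<close>, then \<open>k\<close> and \<open>i\<close> by the one for \<open>B\<close>, then
      \<open>i\<close> and \<open>l\<close> by the one for \<open>A\<close>.\<close>
    have "contract (D $ l * (?a k * ?b i)) f = contract (?b i * (D $ l * ?a k)) f"
      by (simp add: ac_simps)
    also have "\<dots> = contract (?b i * (D $ k * ?a l)) f"
      by (intro contract_mult_left_cong a l k)
    also have "\<dots> = contract (?a l * (D $ k * ?b i)) f"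
      by (simp add: ac_simps)
    also have "\<dots> = contract (?a l * (D $ i * ?b k)) f"
      by (intro contract_mult_left_cong b i k)
    also have "\<dots> = contract (?b k * (D $ i * ?a l)) f"
      by (simp add: ac_simps)
    also have "\<dots> = contract (?b k * (D $ l * ?a i)) f"
      by (intro contract_mult_left_cong a i l)
    also have "\<dots> = contract (D $ l * (?a i * ?b k)) f"
      by (simp add: ac_simps)
    finally have "contract (D $ l * (?a k * ?b i - ?a i * ?b k)) f = 0"
      by (simp add: right_diff_distrib contract_diff_left)
    then show "contract (D $ l) ?h = 0"
      by (simp add: contract_mult[of "D $ l"] contract_diff_left)
  qed
  then show ?thesis
    by simp
qed

lemma mult_in_Mset:
  assumes A: "A \<in> Mset f D" and B: "B \<in> Mset f D" and f: "f \<in> graded_piece d" and d: "3 * e \<le> d"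
  shows "A * B \<in> Mset f D"
proof -
  have "A \<in> carrier_mat n n" "B \<in> carrier_mat n n"
    using A B by (auto simp: Mset_iff n)
  then show ?thesis
    using contract_mact_mult[OF n _ B, of A] contract_mact_swap[OF A B f d]
    by (simp add: Mset_iff n[symmetric])
qed

text \<open>
  Both \<open>D\<^sub>i (ABD)\<^sub>k\<close> and \<open>D\<^sub>i (BAD)\<^sub>k\<close> are congruent to \<open>(AD)\<^sub>i (BD)\<^sub>k\<close>; cancelling \<open>D\<^sub>i\<close> puts the
  difference of the two entries into \<open>ann f\<close>, in degree \<open>e\<close>.
\<close>
lemma mult_commute_in_Mset:
  assumes A: "A \<in> Mset f D" and B: "B \<in> Mset f D" and f: "f \<in> graded_piece d" and d: "3 * e \<le> d"
    and ann: "ann f \<inter> graded_piece e = {0}"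
  shows "A * B = B * A"
proof (rule mact_inject)
  have Ac: "A \<in> carrier_mat n n" and Bc: "B \<in> carrier_mat n n"
    using A B by (auto simp: Mset_iff n)
  then show "A * B \<in> carrier_mat n n" "B * A \<in> carrier_mat n n"
    by auto
  fix k assume k: "k < n"
  let ?g = "mact D (A * B) k - mact D (B * A) k"
  have g: "?g \<in> graded_piece e"
    using mact_in_graded_piece[of "A * B" k] mact_in_graded_piece[of "B * A" k]
      Poly_Mapping.keys_diff by (fastforce simp: graded_piece_def)
  have "contract ?g f = 0"
  proof (rule contracted_to_zero_by_basis)
    show "contract ?g f \<in> graded_piece (d - e)"
      by (rule contract_graded_piece[OF g f])
    show "e \<le> d - e"
      using d by simp
    fix i assume i: "i < n"
    have "contract (D $ i * mact D (A * B) k) f = contract (mact D A k * mact D B i) f"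
      by (rule contract_mact_mult[OF n Ac B i k])
    also have "\<dots> = contract (mact D A i * mact D B k) f"
      by (rule contract_mact_swap[OF A B f d i k])
    also have "\<dots> = contract (D $ i * mact D (B * A) k) f"
      by (simp add: contract_mact_mult[OF n Bc A i k] mult.commute)
    finally have "contract (D $ i * ?g) f = 0"
      by (simp add: right_diff_distrib contract_diff_left)
    then show "contract (D $ i) (contract ?g f) = 0"
      by (simp only: contract_mult)
  qed
  then have "?g \<in> ann f \<inter> graded_piece e"
    using g by (simp add: ann_def)
  then show "mact D (A * B) k = mact D (B * A) k"
    using ann by simp
qed

end

section \<open>The matrix algebra\<close>

text \<open>
  \<open>Mset f D\<close> is always a linear subspace containing the identity matrix, because its defining
  relations are linear in \<open>A\<close> and hold trivially for the identity; only multiplication is at stake.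
\<close>
lemma algebra_Malg:
  assumes mult: "\<And>A B. A \<in> Mset f D \<Longrightarrow> B \<in> Mset f D \<Longrightarrow> A * B \<in> Mset f D"
    and comm: "\<And>A B. A \<in> Mset f D \<Longrightarrow> B \<in> Mset f D \<Longrightarrow> A * B = B * A"
  shows "algebra (class_ring :: 'k::field ring) (Malg f (D :: ('r::finite, 'k) mpoly vec))"
proof -
  define n where "n = dim_vec D"
  note closed = zero_in_Mset[OF n_def] one_in_Mset[OF n_def] add_in_Mset[OF n_def]
    smult_in_Mset[OF n_def] mult
  have carrier: "A \<in> carrier_mat n n" if "A \<in> Mset f D" for A
    using that by (simp add: Mset_iff n_def)
  have simps: "carrier (Malg f D) = Mset f D" "mult (Malg f D) = (*)" "add (Malg f D) = (+)"
    "one (Malg f D) = 1\<^sub>m n" "zero (Malg f D) = 0\<^sub>m n n" "smult (Malg f D) = (\<cdot>\<^sub>m)"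
    by (simp_all add: Malg_def module_mat_def n_def)
  have group: "abelian_group (Malg f D)"
  proof (rule abelian_groupI; unfold simps)
    fix A assume A: "A \<in> Mset f D"
    have "(-1) \<cdot>\<^sub>m A + A = 0\<^sub>m n n"
      using carrier[OF A] by (intro eq_matI) auto
    then show "\<exists>B\<in>Mset f D. B + A = 0\<^sub>m n n"
      using closed(4)[OF A] by blast
  qed (auto intro: closed comm_add_mat[OF carrier carrier]
      assoc_add_mat[OF carrier carrier carrier] left_add_zero_mat[OF carrier])
  have monoid: "comm_monoid (Malg f D)"
    by (rule comm_monoidI; unfold simps)
      (auto intro: closed comm dest: carrier simp: assoc_mult_mat[OF carrier carrier carrier])
  have scalars: "(a * b) \<cdot>\<^sub>m A = a \<cdot>\<^sub>m (b \<cdot>\<^sub>m A)" "1 \<cdot>\<^sub>m A = A" for a b and A :: "'k mat"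
    by (rule eq_matI; simp add: mult.assoc)+
  show ?thesis
  proof (rule algebraI)
    show "cring (Malg f D)"
    proof (rule cringI[OF group monoid]; unfold simps)
      fix A B C assume "A \<in> Mset f D" "B \<in> Mset f D" "C \<in> Mset f D"
      then show "(A + B) * C = A * C + B * C"
        by (intro add_mult_distrib_mat[OF carrier carrier carrier])
    qed
  qed (auto simp: simps class_cring.cring_axioms scalars intro: closed
      add_smult_distrib_right_mat[OF carrier] add_smult_distrib_left_mat[OF carrier carrier]
      mult_smult_assoc_mat[OF carrier carrier])
qed

theorem proposition5p11:
  fixes f :: "('r::finite, 'k::field) divpow"
    and D :: "('r, 'k) mpoly vec"
    and d e N :: nat
  assumes "e \<ge> 1"
    and "d \<ge> 3 * e"
    and "f \<in> graded_piece d"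
    and "N = (CARD('r) - 1 + e) choose e"
    and "D \<in> carrier_vec N"
    and "is_basis D (graded_piece e)"
  shows "(\<forall>A\<in>Mset f D. \<forall>B\<in>Mset f D. A * B \<in> Mset f D) \<and>
    (ann f \<inter> graded_piece e = {0} \<longrightarrow>
      algebra (class_ring :: 'k ring) (Malg f D))"
proof -
  have mult: "A * B \<in> Mset f D" if "A \<in> Mset f D" "B \<in> Mset f D" for A B
    by (rule mult_in_Mset[OF assms(6) refl that assms(3,2)])
  moreover have "algebra (class_ring :: 'k ring) (Malg f D)"
    if ann: "ann f \<inter> graded_piece e = {0}"
    by (rule algebra_Malg[OF mult mult_commute_in_Mset[OF assms(6) refl _ _ assms(3,2) ann]])
  ultimately show ?thesis
    by blast
qed

end
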